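(* For every variable $x\in V$, every command $c\in\mathcal C$ and every relation $r\subseteq\Sigma\times\Sigma$, $$(\mathbf{var}\,x\cdot c)\Cap\mathbf{rely}\,r\;\ge\;\big(\mathbf{var}\,x\cdot c\Cap\mathbf{rely}((\mathsf E_xr)\cap\mathrm{id}(x))\big).$$
   Context: Commands. $(\mathcal C,\le,\bigwedge,\bigsqcup,\bot,\top)$ is a complete distributive lattice (with arbitrary meet $\bigwedge$, binary meet $\sqcap$, arbitrary join $\bigsqcup$ and binary join $\sqcup$) whose elements are called commands ($c\ge d$ is read "$c$ is refined by $d$"). It has an associative sequential composition $;$ with identity $\mathbf{nil}$, monotone in both arguments, and an associative, commutative, idempotent, monotone weak conjunction $\Cap$. Iterations: $c^0=\mathbf{nil}$, $c^{i+1}=c;c^i$; $c^\star$ (resp. $c^\omega$) is the least (resp. greatest) fixed point of $y\mapsto\mathbf{nil}\sqcup c;y$; $c^\infty=c^\omega;\bot$. One has $c^\star=\bigsqcup_{i\in\mathbb N}c^i$ and $c^\omega=c^\star\sqcup c^\infty$. States and relations. $V$ is a countable set of variables, $S$ a set, $\Sigma$ the set of partial functions $V\rightharpoonup S$. For $W\subseteq V$, $\mathrm{id}(W)$ relates $\sigma,\sigma'\in\Sigma$ iff they agree on every variable in $W$; $\mathrm{id}(x)=\mathrm{id}(\{x\})$, $\mathrm{id}(\overline x)=\mathrm{id}(V\setminus\{x\})$, and $\mathrm{id}$ is the identity relation on $\Sigma$. For $p\subseteq\Sigma$, $\mathsf E_x p$ is the image of $p$ under $\mathrm{id}(\overline x)$.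 For $r\subseteq\Sigma\times\Sigma$ (with $\circ$ denoting left-to-right relational composition), $\mathsf E^{\mathsf{first}}_x r=\mathrm{id}(\overline x)\circ r$, $\mathsf E^{\mathsf{last}}_x r=r\circ\mathrm{id}(\overline x)$, $\mathsf E_x r=\mathrm{id}(\overline x)\circ r\circ\mathrm{id}(\overline x)$. $\overline r$ is the complement of $r$. A relation $g$ is reflexive if $\mathrm{id}\subseteq g$. Primitive commands. $\tau:\mathcal P(\Sigma)\to\mathcal C$ (tests) and $\pi,\epsilon:\mathcal P(\Sigma\times\Sigma)\to\mathcal A$ (program and environment steps) are injective homomorphisms of complete Boolean algebras onto complete Boolean sub-algebras of $\mathcal C$ (joins, and nonempty meets, computed in $\mathcal C$; complement relative to the greatest element of the sub-algebra), with $\tau(\emptyset)=\pi(\emptyset)=\epsilon(\emptyset)=\bot$ and $\tau(\Sigma)=\mathbf{nil}$. $\mathcal A\subseteq\mathcal C$ is the complete Boolean sub-algebra of atomic steps, in which $\boldsymbol\pi=\pi(\Sigma\times\Sigma)$ and $\boldsymbol\epsilon=\epsilon(\Sigma\times\Sigma)$ are complementary; $\boldsymbol\alpha=\boldsymbol\pi\sqcup\boldsymbol\epsilon$. $\mathbf{chaos}=\boldsymbol\alpha^\omega$ is the identity of $\Cap$, and $a=a\Cap(\boldsymbol\alpha;\mathbf{chaos})$ for all $a\in\mathcal A$. Localisation. For each $x\in V$ there are unary operators $\mathsf E_x,\mathsf E^{\mathsf{first}}_x,\mathsf E^{\mathsf{last}}_x$ on $\mathcal C$ (binding tighter than binary operators).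 Each family $F\in\{\mathsf E,\mathsf E^{\mathsf{first}},\mathsf E^{\mathsf{last}}\}$ satisfies $c\le F_xc$; $F_x(c\sqcap F_xd)=F_xc\sqcap F_xd$; $F_xF_yc=F_yF_xc$; $F_x(\bigsqcup C)=\bigsqcup_{c\in C}F_xc$. Further axioms: $\mathsf E^{\mathsf{first}}_xc\le\mathsf E_xc$; $\mathsf E^{\mathsf{last}}_xc\le\mathsf E_xc$; $\mathsf E_x\mathsf E^{\mathsf{first}}_yc=\mathsf E^{\mathsf{first}}_y\mathsf E_xc$; $\mathsf E_x\mathsf E^{\mathsf{last}}_yc=\mathsf E^{\mathsf{last}}_y\mathsf E_xc$; $\mathsf E^{\mathsf{first}}_x\mathsf E^{\mathsf{last}}_yc=\mathsf E^{\mathsf{last}}_y\mathsf E^{\mathsf{first}}_xc$; $\mathsf E_x\tau(p)=\mathsf E^{\mathsf{first}}_x\tau(p)=\mathsf E^{\mathsf{last}}_x\tau(p)=\tau(\mathsf E_xp)$; $F_x\pi(r)=\pi(F_xr)$ and $F_x\epsilon(r)=\epsilon(F_xr)$ for each of the three $F$; $\mathsf E_x(c;\mathsf E^{\mathsf{first}}_xd)=\mathsf E_xc;\mathsf E_xd=\mathsf E_x(\mathsf E^{\mathsf{last}}_xc;d)$; if $c=c\Cap(\boldsymbol\alpha;\mathbf{chaos})$ then $\mathsf E^{\mathsf{first}}_x(c;d)=\mathsf E^{\mathsf{first}}_xc;d$ and $\mathsf E^{\mathsf{last}}_x(d;c)=d;\mathsf E^{\mathsf{last}}_xc$; $\mathsf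 E_x(c\Cap\mathsf E_xd)=\mathsf E_xc\Cap\mathsf E_xd$; $\mathsf E^{\mathsf{first}}_x(c\Cap\mathsf E^{\mathsf{first}}_xd)=\mathsf E^{\mathsf{first}}_xc\Cap\mathsf E^{\mathsf{first}}_xd$; for $a\in\mathcal A$ with $\mathsf E_xa=\mathsf E^{\mathsf{last}}_xa$, $\mathsf E_x(a^\infty)=(\mathsf E_xa)^\infty$. Derived commands. $\mathbf{guar}\,g=(\pi(g)\sqcup\boldsymbol\epsilon)^\omega$; $\mathbf{demand}\,r=(\epsilon(r)\sqcup\boldsymbol\pi)^\omega$; $\mathbf{rely}\,r=(\boldsymbol\alpha\sqcup\epsilon(\overline r);\top)^\omega=\boldsymbol\alpha^\omega;(\mathbf{nil}\sqcup\epsilon(\overline r);\top)$; $\mathbf{term}=\boldsymbol\alpha^\star;\boldsymbol\epsilon^\omega$; $\mathbf{idle}=\mathbf{term}\Cap\mathbf{guar}\,\mathrm{id}$. Known properties of the algebra: $\mathbf{guar}\,g_1\Cap\mathbf{guar}\,g_2=\mathbf{guar}(g_1\cap g_2)$; $\mathbf{guar}\,g\Cap(c;d)=(\mathbf{guar}\,g\Cap c);(\mathbf{guar}\,g\Cap d)$; $\mathbf{rely}\,r_1\ge\mathbf{rely}\,r_2$ if $r_1\subseteq r_2$; $\mathbf{rely}\,r\Cap c\ge c$; $\mathbf{rely}\,r_1\Cap\mathbf{rely}\,r_2=\mathbf{rely}(r_1\cap r_2)$; $\mathbf{rely}\,r\Cap(c;d)\ge(\mathbf{rely}\,r\Cap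 c);(\mathbf{rely}\,r\Cap d)$; $\mathbf{demand}\,r\Cap\mathbf{rely}\,r=\mathbf{demand}\,r$; $\mathbf{idle}=\mathbf{idle}\Cap\mathbf{guar}\,g$ if $g$ is reflexive. Local blocks. $(\mathbf{local}\,x\cdot c)=\mathsf E_x(\mathbf{demand}\,\mathrm{id}(x)\Cap c)\Cap\mathbf{guar}\,\mathrm{id}(x)$ and $(\mathbf{var}\,x\cdot c)=\mathbf{idle};(\mathbf{local}\,x\cdot c);\mathbf{idle}$. *)

theory Defs
  imports Main "HOL-Library.Countable"
begin

unbundle lattice_syntax

text \<open>
  Relational composition \<open>O\<close> of the library is left-to-right. Agreement on a variable on which
  a state may be undefined is equality of options.
\<close>

type_synonym ('v, 's) state = "'v \<rightharpoonup> 's"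
type_synonym ('v, 's) state_rel = "(('v, 's) state \<times> ('v, 's) state) set"

definition id_on :: "'v set \<Rightarrow> ('v, 's) state_rel" where
  "id_on W = {(\<sigma>, \<sigma>'). \<forall>y\<in>W. \<sigma> y = \<sigma>' y}"

definition pred_E :: "'v \<Rightarrow> ('v, 's) state set \<Rightarrow> ('v, 's) state set" where
  "pred_E x p = id_on (- {x}) `` p"

definition rel_E_first :: "'v \<Rightarrow> ('v, 's) state_rel \<Rightarrow> ('v, 's) state_rel" where
  "rel_E_first x r = id_on (- {x}) O r"

definition rel_E_last :: "'v \<Rightarrow> ('v, 's) state_rel \<Rightarrow> ('v, 's) state_rel" where
  "rel_E_last x r = r O id_on (- {x})"

definition rel_E :: "'v \<Rightarrow> ('v, 's) state_rel \<Rightarrow> ('v, 's) state_rel" where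
  "rel_E x r = id_on (- {x}) O r O id_on (- {x})"

text \<open>
  The carrier of commands is a whole type \<open>'c\<close>, ordered so that \<open>c \<ge> d\<close> means that \<open>c\<close> is
  refined by \<open>d\<close>. Distributivity of the lattice is the finite law (class \<open>distrib_lattice\<close>);
  the library's class \<open>complete_distrib_lattice\<close> is complete distributivity, which is stronger
  and is not assumed.
\<close>

record ('c, 'v, 's) command_ops =
  seq :: "'c \<Rightarrow> 'c \<Rightarrow> 'c"  (infixr "\<^bold>;\<index>" 75)
  nil :: "'c"  ("nil\<index>")
  weak_conj :: "'c \<Rightarrow> 'c \<Rightarrow> 'c"  (infixl "\<^bold>\<inter>\<index>" 70)
  tst :: "('v, 's) state set \<Rightarrow> 'c"  ("\<tau>\<index>")
  pgm :: "('v, 's) state_rel \<Rightarrow> 'c"  ("\<pi>\<index>")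
  env :: "('v, 's) state_rel \<Rightarrow> 'c"  ("\<epsilon>\<index>")
  atomic :: "'c set"  ("\<A>\<index>")
  loc :: "'v \<Rightarrow> 'c \<Rightarrow> 'c"  ("E\<index>")
  loc_first :: "'v \<Rightarrow> 'c \<Rightarrow> 'c"  ("Efirst\<index>")
  loc_last :: "'v \<Rightarrow> 'c \<Rightarrow> 'c"  ("Elast\<index>")

primrec cpow ::
  "('c::complete_lattice, 'v, 's) command_ops \<Rightarrow> 'c \<Rightarrow> nat \<Rightarrow> 'c" where
  "cpow K c 0 = nil\<^bsub>K\<^esub>"
| "cpow K c (Suc i) = c \<^bold>;\<^bsub>K\<^esub> cpow K c i"

definition fin_iter ::
  "('c::complete_lattice, 'v, 's) command_ops \<Rightarrow> 'c \<Rightarrow> 'c"  ("_\<^sup>\<star>\<index>" [1000] 999) where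
  "c\<^sup>\<star>\<^bsub>K\<^esub> = lfp (\<lambda>y. nil\<^bsub>K\<^esub> \<squnion> (c \<^bold>;\<^bsub>K\<^esub> y))"

definition omega_iter ::
  "('c::complete_lattice, 'v, 's) command_ops \<Rightarrow> 'c \<Rightarrow> 'c"  ("_\<^sup>\<omega>\<index>" [1000] 999) where
  "c\<^sup>\<omega>\<^bsub>K\<^esub> = gfp (\<lambda>y. nil\<^bsub>K\<^esub> \<squnion> (c \<^bold>;\<^bsub>K\<^esub> y))"

definition inf_iter ::
  "('c::complete_lattice, 'v, 's) command_ops \<Rightarrow> 'c \<Rightarrow> 'c"  ("_\<^sup>\<infinity>\<index>" [1000] 999) where
  "c\<^sup>\<infinity>\<^bsub>K\<^esub> = c\<^sup>\<omega>\<^bsub>K\<^esub> \<^bold>;\<^bsub>K\<^esub> \<bottom>"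

definition any_pgm :: "('c::complete_lattice, 'v, 's) command_ops \<Rightarrow> 'c"  ("\<^bold>\<pi>\<index>") where
  "\<^bold>\<pi>\<^bsub>K\<^esub> = \<pi>\<^bsub>K\<^esub> UNIV"

definition any_env :: "('c::complete_lattice, 'v, 's) command_ops \<Rightarrow> 'c"  ("\<^bold>\<epsilon>\<index>") where
  "\<^bold>\<epsilon>\<^bsub>K\<^esub> = \<epsilon>\<^bsub>K\<^esub> UNIV"

definition any_step :: "('c::complete_lattice, 'v, 's) command_ops \<Rightarrow> 'c"  ("\<^bold>\<alpha>\<index>") where
  "\<^bold>\<alpha>\<^bsub>K\<^esub> = \<^bold>\<pi>\<^bsub>K\<^esub> \<squnion> \<^bold>\<epsilon>\<^bsub>K\<^esub>"

definition chaos :: "('c::complete_lattice, 'v, 's) command_ops \<Rightarrow> 'c"  ("chaos\<index>") where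
  "chaos\<^bsub>K\<^esub> = \<^bold>\<alpha>\<^bsub>K\<^esub>\<^sup>\<omega>\<^bsub>K\<^esub>"

definition guar ::
  "('c::complete_lattice, 'v, 's) command_ops \<Rightarrow> ('v, 's) state_rel \<Rightarrow> 'c"  ("guar\<index>") where
  "guar\<^bsub>K\<^esub> g = (\<pi>\<^bsub>K\<^esub> g \<squnion> \<^bold>\<epsilon>\<^bsub>K\<^esub>)\<^sup>\<omega>\<^bsub>K\<^esub>"

definition demand ::
  "('c::complete_lattice, 'v, 's) command_ops \<Rightarrow> ('v, 's) state_rel \<Rightarrow> 'c"  ("demand\<index>") where
  "demand\<^bsub>K\<^esub> r = (\<epsilon>\<^bsub>K\<^esub> r \<squnion> \<^bold>\<pi>\<^bsub>K\<^esub>)\<^sup>\<omega>\<^bsub>K\<^esub>"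

definition rely ::
  "('c::complete_lattice, 'v, 's) command_ops \<Rightarrow> ('v, 's) state_rel \<Rightarrow> 'c"  ("rely\<index>") where
  "rely\<^bsub>K\<^esub> r = (\<^bold>\<alpha>\<^bsub>K\<^esub> \<squnion> (\<epsilon>\<^bsub>K\<^esub> (- r) \<^bold>;\<^bsub>K\<^esub> \<top>))\<^sup>\<omega>\<^bsub>K\<^esub>"

definition cterm :: "('c::complete_lattice, 'v, 's) command_ops \<Rightarrow> 'c"  ("term\<index>") where
  "term\<^bsub>K\<^esub> = \<^bold>\<alpha>\<^bsub>K\<^esub>\<^sup>\<star>\<^bsub>K\<^esub> \<^bold>;\<^bsub>K\<^esub> \<^bold>\<epsilon>\<^bsub>K\<^esub>\<^sup>\<omega>\<^bsub>K\<^esub>"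

definition idle :: "('c::complete_lattice, 'v, 's) command_ops \<Rightarrow> 'c"  ("idle\<index>") where
  "idle\<^bsub>K\<^esub> = term\<^bsub>K\<^esub> \<^bold>\<inter>\<^bsub>K\<^esub> guar\<^bsub>K\<^esub> Id"

definition local_block ::
  "('c::complete_lattice, 'v, 's) command_ops \<Rightarrow> 'v \<Rightarrow> 'c \<Rightarrow> 'c"  ("local\<index>") where
  "local\<^bsub>K\<^esub> x c = E\<^bsub>K\<^esub> x (demand\<^bsub>K\<^esub> (id_on {x}) \<^bold>\<inter>\<^bsub>K\<^esub> c) \<^bold>\<inter>\<^bsub>K\<^esub> guar\<^bsub>K\<^esub> (id_on {x})"

definition var_block ::
  "('c::complete_lattice, 'v, 's) command_ops \<Rightarrow> 'v \<Rightarrow> 'c \<Rightarrow> 'c"  ("var\<index>") where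
  "var\<^bsub>K\<^esub> x c = idle\<^bsub>K\<^esub> \<^bold>;\<^bsub>K\<^esub> local\<^bsub>K\<^esub> x c \<^bold>;\<^bsub>K\<^esub> idle\<^bsub>K\<^esub>"

text \<open>
  Joins (including the empty one, so that the least element is \<open>\<bottom>\<close>) and nonempty meets are
  those of the ambient lattice; complements are relative to the greatest element \<open>\<Squnion>B\<close>.
\<close>

definition complete_boolean_subalgebra :: "'c::complete_lattice set \<Rightarrow> bool" where
  "complete_boolean_subalgebra B \<longleftrightarrow>
     (\<forall>X\<subseteq>B. \<Squnion>X \<in> B) \<and>
     (\<forall>X\<subseteq>B. X \<noteq> {} \<longrightarrow> \<Sqinter>X \<in> B) \<and>
     (\<forall>b\<in>B. \<exists>b'\<in>B. b \<sqinter> b' = \<bottom> \<and> b \<squnion> b' = \<Squnion>B)"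

definition complete_boolean_embedding :: "('a set \<Rightarrow> 'c::complete_lattice) \<Rightarrow> bool" where
  "complete_boolean_embedding f \<longleftrightarrow>
     inj f \<and>
     complete_boolean_subalgebra (range f) \<and>
     (\<forall>P. f (\<Union>P) = \<Squnion>(f ` P)) \<and>
     (\<forall>P. P \<noteq> {} \<longrightarrow> f (\<Inter>P) = \<Sqinter>(f ` P)) \<and>
     (\<forall>p. f p \<sqinter> f (- p) = \<bottom> \<and> f p \<squnion> f (- p) = f UNIV)"

definition localisation_family :: "('v \<Rightarrow> 'c \<Rightarrow> 'c::complete_lattice) \<Rightarrow> bool" where
  "localisation_family F \<longleftrightarrow>
     (\<forall>x c. c \<le> F x c) \<and>
     (\<forall>x c d. F x (c \<sqinter> F x d) = F x c \<sqinter> F x d) \<and>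
     (\<forall>x y c. F x (F y c) = F y (F x c)) \<and>
     (\<forall>x C. F x (\<Squnion>C) = (\<Squnion>c\<in>C. F x c))"

locale localisation_algebra =
  fixes K :: "('c::{complete_lattice, distrib_lattice}, 'v::countable, 's) command_ops" (structure)
  assumes seq_assoc: "(c \<^bold>; d) \<^bold>; e = c \<^bold>; (d \<^bold>; e)"
    and nil_seq: "nil \<^bold>; c = c"
    and seq_nil: "c \<^bold>; nil = c"
    and seq_mono: "c \<le> c' \<Longrightarrow> d \<le> d' \<Longrightarrow> c \<^bold>; d \<le> c' \<^bold>; d'"
    and conj_assoc: "(c \<^bold>\<inter> d) \<^bold>\<inter> e = c \<^bold>\<inter> (d \<^bold>\<inter> e)"
    and conj_commute: "c \<^bold>\<inter> d = d \<^bold>\<inter> c"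
    and conj_idem: "c \<^bold>\<inter> c = c"
    and conj_mono: "c \<le> c' \<Longrightarrow> d \<le> d' \<Longrightarrow> c \<^bold>\<inter> d \<le> c' \<^bold>\<inter> d'"
    and chaos_conj: "chaos \<^bold>\<inter> c = c"
    and fin_iter_eq: "c\<^sup>\<star> = (\<Squnion>i. cpow K c i)"
    and omega_iter_eq: "c\<^sup>\<omega> = c\<^sup>\<star> \<squnion> c\<^sup>\<infinity>"
    and tst_embedding: "complete_boolean_embedding \<tau>"
    and pgm_embedding: "complete_boolean_embedding \<pi>"
    and env_embedding: "complete_boolean_embedding \<epsilon>"
    and tst_empty: "\<tau> {} = \<bottom>"
    and pgm_empty: "\<pi> {} = \<bottom>"
    and env_empty: "\<epsilon> {} = \<bottom>"
    and tst_UNIV: "\<tau> UNIV = nil"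
    and atomic_subalgebra: "complete_boolean_subalgebra \<A>"
    and pgm_atomic: "\<pi> r \<in> \<A>"
    and env_atomic: "\<epsilon> r \<in> \<A>"
    and pgm_env_disjoint: "\<^bold>\<pi> \<sqinter> \<^bold>\<epsilon> = \<bottom>"
    and pgm_env_exhaustive: "\<^bold>\<pi> \<squnion> \<^bold>\<epsilon> = \<Squnion>\<A>"
    and atomic_conj: "a \<in> \<A> \<Longrightarrow> a = a \<^bold>\<inter> (\<^bold>\<alpha> \<^bold>; chaos)"
    and loc_family: "localisation_family E"
    and loc_first_family: "localisation_family Efirst"
    and loc_last_family: "localisation_family Elast"
    and loc_first_le_loc: "Efirst x c \<le> E x c"
    and loc_last_le_loc: "Elast x c \<le> E x c"
    and loc_loc_first: "E x (Efirst y c) = Efirst y (E x c)"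
    and loc_loc_last: "E x (Elast y c) = Elast y (E x c)"
    and loc_first_loc_last: "Efirst x (Elast y c) = Elast y (Efirst x c)"
    and loc_tst: "E x (\<tau> p) = \<tau> (pred_E x p)"
    and loc_first_tst: "Efirst x (\<tau> p) = \<tau> (pred_E x p)"
    and loc_last_tst: "Elast x (\<tau> p) = \<tau> (pred_E x p)"
    and loc_pgm: "E x (\<pi> r) = \<pi> (rel_E x r)"
    and loc_first_pgm: "Efirst x (\<pi> r) = \<pi> (rel_E_first x r)"
    and loc_last_pgm: "Elast x (\<pi> r) = \<pi> (rel_E_last x r)"
    and loc_env: "E x (\<epsilon> r) = \<epsilon> (rel_E x r)"
    and loc_first_env: "Efirst x (\<epsilon> r) = \<epsilon> (rel_E_first x r)"
    and loc_last_env: "Elast x (\<epsilon> r) = \<epsilon> (rel_E_last x r)"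
    and loc_seq_first: "E x (c \<^bold>; Efirst x d) = E x c \<^bold>; E x d"
    and loc_seq_last: "E x (Elast x c \<^bold>; d) = E x c \<^bold>; E x d"
    and loc_first_seq: "c = c \<^bold>\<inter> (\<^bold>\<alpha> \<^bold>; chaos) \<Longrightarrow> Efirst x (c \<^bold>; d) = Efirst x c \<^bold>; d"
    and loc_last_seq: "c = c \<^bold>\<inter> (\<^bold>\<alpha> \<^bold>; chaos) \<Longrightarrow> Elast x (d \<^bold>; c) = d \<^bold>; Elast x c"
    and loc_conj: "E x (c \<^bold>\<inter> E x d) = E x c \<^bold>\<inter> E x d"
    and loc_first_conj: "Efirst x (c \<^bold>\<inter> Efirst x d) = Efirst x c \<^bold>\<inter> Efirst x d"
    and loc_inf_iter: "a \<in> \<A> \<Longrightarrow> E x a = Elast x a \<Longrightarrow> E x (a\<^sup>\<infinity>) = (E x a)\<^sup>\<infinity>"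
    and rely_eq: "rely r = \<^bold>\<alpha>\<^sup>\<omega> \<^bold>; (nil \<squnion> (\<epsilon> (- r) \<^bold>; \<top>))"
    and guar_conj_guar: "guar g1 \<^bold>\<inter> guar g2 = guar (g1 \<inter> g2)"
    and guar_conj_seq: "guar g \<^bold>\<inter> (c \<^bold>; d) = (guar g \<^bold>\<inter> c) \<^bold>; (guar g \<^bold>\<inter> d)"
    and rely_weaken: "r1 \<subseteq> r2 \<Longrightarrow> rely r1 \<ge> rely r2"
    and rely_remove: "rely r \<^bold>\<inter> c \<ge> c"
    and rely_conj_rely: "rely r1 \<^bold>\<inter> rely r2 = rely (r1 \<inter> r2)"
    and rely_conj_seq: "rely r \<^bold>\<inter> (c \<^bold>; d) \<ge> (rely r \<^bold>\<inter> c) \<^bold>; (rely r \<^bold>\<inter> d)"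
    and demand_conj_rely: "demand r \<^bold>\<inter> rely r = demand r"
    and idle_conj_guar: "Id \<subseteq> g \<Longrightarrow> idle = idle \<^bold>\<inter> guar g"

end

(* The demand on id(x) absorbs a rely on id(x), so inside the local block the rely may be read as
   rely (E_x r). This relation is saturated with respect to x, which makes rely (E_x r) a fixed
   point of E_x; hence it can be pulled out of the block, where it is refined from rely r because
   r is contained in E_x r. *)
theory Submission
  imports Defs
begin

lemma id_on_trans: "(a, b) \<in> id_on W \<Longrightarrow> (b, c) \<in> id_on W \<Longrightarrow> (a, c) \<in> id_on W"
  by (simp add: id_on_def)

lemma id_on_sym: "(a, b) \<in> id_on W \<Longrightarrow> (b, a) \<in> id_on W"
  by (simp add: id_on_def)

lemma id_on_refl [simp]: "(a, a) \<in> id_on W"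
  by (simp add: id_on_def)

lemma subset_rel_E: "r \<subseteq> rel_E x r"
  unfolding rel_E_def by (auto intro!: relcompI[OF id_on_refl] relcompI[OF _ id_on_refl])

lemma subset_rel_E_last: "r \<subseteq> rel_E_last x r"
  unfolding rel_E_last_def by (auto intro: relcompI[OF _ id_on_refl])

lemma rel_E_UNIV [simp]: "rel_E x UNIV = UNIV"
  by (rule top_le[OF subset_rel_E])

lemma rel_E_last_UNIV [simp]: "rel_E_last x UNIV = UNIV"
  by (rule top_le[OF subset_rel_E_last])

lemma pred_E_UNIV [simp]: "pred_E x UNIV = UNIV"
  unfolding pred_E_def by (auto intro: ImageI[OF id_on_refl])

text \<open>Saturation: \<open>id_on (- {x})\<close> is an equivalence, so the two outer factors of
  \<open>rel_E x r\<close> absorb any change of \<open>x\<close> at either end.\<close>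

lemma mem_rel_E_iff:
  assumes "(a, a') \<in> id_on (- {x})" "(b, b') \<in> id_on (- {x})"
  shows "(a, b) \<in> rel_E x r \<longleftrightarrow> (a', b') \<in> rel_E x r"
proof -
  have "(a', b') \<in> rel_E x r"
    if ab: "(a, b) \<in> rel_E x r" and eq: "(a, a') \<in> id_on (- {x})" "(b, b') \<in> id_on (- {x})" for a a' b b'
  proof -
    from ab obtain s t where "(a, s) \<in> id_on (- {x})" "(s, t) \<in> r" "(t, b) \<in> id_on (- {x})"
      unfolding rel_E_def by blast
    then have "(a', s) \<in> id_on (- {x})" "(s, t) \<in> r" "(t, b') \<in> id_on (- {x})"
      using id_on_trans[OF id_on_sym[OF eq(1)]] id_on_trans[OF _ eq(2)] by simp_all
    then show ?thesis
      unfolding rel_E_def by (intro relcompI)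
  qed
  \<comment> \<open>The implication was proved for arbitrary states, so symmetry of the hypotheses
    gives the converse.\<close>
  from this[OF _ assms] this[OF _ assms[THEN id_on_sym]] show ?thesis by blast
qed

text \<open>The complement of a saturated relation is saturated. The complement matters because
  \<open>rely\<close> uses its relation only through \<open>\<epsilon> (- r)\<close>.\<close>

lemma rel_E_compl_rel_E: "rel_E x (- rel_E x r) = - rel_E x r"
proof
  show "rel_E x (- rel_E x r) \<subseteq> - rel_E x r"
  proof
    fix p assume p: "p \<in> rel_E x (- rel_E x r)"
    obtain a b where ab: "p = (a, b)" by (cases p)
    with p obtain a' b' where "(a, a') \<in> id_on (- {x})" "(a', b') \<in> - rel_E x r"
      "(b', b) \<in> id_on (- {x})"
      unfolding rel_E_def[of x "- rel_E x r"] by blast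
    then show "p \<in> - rel_E x r"
      using mem_rel_E_iff[OF _ id_on_sym, of a a' x b' b r] ab by simp
  qed
qed (rule subset_rel_E)

lemma rel_E_first_subset: "rel_E_first x r \<subseteq> rel_E x r"
  unfolding rel_E_def rel_E_first_def by (auto intro: relcompI[OF _ id_on_refl])

lemma rel_E_last_subset: "rel_E_last x r \<subseteq> rel_E x r"
  unfolding rel_E_def rel_E_last_def by (auto intro: relcompI[OF id_on_refl])

lemma subset_rel_E_first: "r \<subseteq> rel_E_first x r"
  unfolding rel_E_first_def by (auto intro: relcompI[OF id_on_refl])

text \<open>One-sided saturation follows from the two-sided kind, since \<open>rel_E_first\<close>
  lies between its argument and \<open>rel_E\<close>.\<close>

lemma rel_E_first_compl_rel_E: "rel_E_first x (- rel_E x r) = - rel_E x r"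
  using rel_E_first_subset[of x "- rel_E x r"] subset_rel_E_first
  unfolding rel_E_compl_rel_E by (rule antisym)

lemma rel_E_last_compl_rel_E: "rel_E_last x (- rel_E x r) = - rel_E x r"
  using rel_E_last_subset[of x "- rel_E x r"] subset_rel_E_last
  unfolding rel_E_compl_rel_E by (rule antisym)

lemma localisation_family_Sup:
  "localisation_family F \<Longrightarrow> F x (\<Squnion>C) = (\<Squnion>c\<in>C. F x c)"
  by (simp add: localisation_family_def)

lemma localisation_family_sup:
  assumes "localisation_family F"
  shows "F x (c \<squnion> d) = F x c \<squnion> F x d"
  using localisation_family_Sup[OF assms, of x "{c, d}"] by simp

lemma localisation_family_increasing: "localisation_family F \<Longrightarrow> c \<le> F x c"
  by (simp add: localisation_family_def)

context localisation_algebra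
begin

lemma conj_left_commute: "c \<^bold>\<inter> (d \<^bold>\<inter> e) = d \<^bold>\<inter> (c \<^bold>\<inter> e)"
  by (simp only: conj_assoc[symmetric] conj_commute[of c d])

lemmas conj_ac = conj_assoc conj_commute conj_left_commute

lemma any_step_atomic: "\<^bold>\<alpha> \<in> \<A>"
  using atomic_subalgebra pgm_env_exhaustive
  by (simp add: complete_boolean_subalgebra_def any_step_def)

lemma loc_any_step: "E x \<^bold>\<alpha> = \<^bold>\<alpha>"
  by (simp add: any_step_def any_pgm_def any_env_def localisation_family_sup[OF loc_family]
      loc_pgm loc_env)

lemma loc_last_any_step: "Elast x \<^bold>\<alpha> = \<^bold>\<alpha>"
  by (simp add: any_step_def any_pgm_def any_env_def localisation_family_sup[OF loc_last_family]
      loc_last_pgm loc_last_env)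

lemma loc_nil: "E x nil = nil"
  using loc_tst[of x UNIV] by (simp add: tst_UNIV)

lemma loc_first_nil: "Efirst x nil = nil"
  using loc_first_tst[of x UNIV] by (simp add: tst_UNIV)

text \<open>Being fixed by \<open>Elast x\<close> lets \<open>c\<close> play the role of
  \<open>Elast x c\<close> in \<open>loc_seq_last\<close>, so \<open>E x\<close> distributes over
  each factor of the power.\<close>

lemma loc_cpow:
  assumes "Elast x c = c" "E x c = c"
  shows "E x (cpow K c i) = cpow K c i"
proof (induction i)
  case (Suc i)
  then show ?case
    using loc_seq_last[of x c "cpow K c i"] assms by simp
qed (simp add: loc_nil)

text \<open>The iteration splits into a finite part, a join of powers, and an infinite part. The
  side condition of \<open>loc_inf_iter\<close> holds because \<open>E x\<close> and
  \<open>Elast x\<close> both fix the atomic step.\<close>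

lemma loc_chaos: "E x (\<^bold>\<alpha>\<^sup>\<omega>) = \<^bold>\<alpha>\<^sup>\<omega>"
proof -
  have "E x (\<^bold>\<alpha>\<^sup>\<star>) = \<^bold>\<alpha>\<^sup>\<star>"
    by (simp add: fin_iter_eq localisation_family_Sup[OF loc_family] image_image
        loc_cpow[OF loc_last_any_step loc_any_step])
  moreover have "E x (\<^bold>\<alpha>\<^sup>\<infinity>) = \<^bold>\<alpha>\<^sup>\<infinity>"
    using loc_inf_iter[OF any_step_atomic] by (simp add: loc_any_step loc_last_any_step)
  ultimately show ?thesis
    by (simp add: omega_iter_eq localisation_family_sup[OF loc_family])
qed

text \<open>By \<open>rely_eq\<close> the command is chaos followed by \<open>?d\<close>.
  Distributing \<open>E x\<close> over this composition needs \<open>?d\<close> to be fixed by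
  \<open>Efirst x\<close>, and the result to be fixed by \<open>E x\<close> as well.\<close>

lemma loc_rely_rel_E: "E x (rely (rel_E x r)) = rely (rel_E x r)"
proof -
  let ?e = "\<epsilon> (- rel_E x r)"
  let ?d = "nil \<squnion> (?e \<^bold>; \<top>)"
  have "Efirst x (?e \<^bold>; \<top>) = ?e \<^bold>; \<top>"
    \<comment> \<open>The composition starts with an atomic step, so \<open>Efirst x\<close> acts on
      that step alone.\<close>
    using loc_first_seq[OF atomic_conj[OF env_atomic]]
    by (simp add: loc_first_env rel_E_first_compl_rel_E)
  then have first: "Efirst x ?d = ?d"
    by (simp add: localisation_family_sup[OF loc_first_family] loc_first_nil)
  have "E x \<top> = \<top>"
    using localisation_family_increasing[OF loc_family] by (simp add: top_le)
  then have "E x (?e \<^bold>; \<top>) = ?e \<^bold>; \<top>"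
    using loc_seq_last[of x ?e \<top>]
    by (simp add: loc_last_env loc_env rel_E_last_compl_rel_E rel_E_compl_rel_E)
  then have "E x ?d = ?d"
    by (simp add: localisation_family_sup[OF loc_family] loc_nil)
  then show ?thesis
    using loc_seq_first[of x "\<^bold>\<alpha>\<^sup>\<omega>" ?d] first
    by (simp add: rely_eq loc_chaos)
qed

text \<open>An equality: only absorption by the demand and \<open>loc_conj\<close> are used, and no
  refinement is lost yet.\<close>

lemma local_block_conj_rely:
  "local x (c \<^bold>\<inter> rely (rel_E x r \<inter> id_on {x})) = local x c \<^bold>\<inter> rely (rel_E x r)"
proof -
  let ?D = "demand (id_on {x})" and ?R = "rely (rel_E x r)"
  have "?D \<^bold>\<inter> (c \<^bold>\<inter> rely (rel_E x r \<inter> id_on {x}))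
      = ?D \<^bold>\<inter> (c \<^bold>\<inter> (?R \<^bold>\<inter> rely (id_on {x})))"
    by (simp add: rely_conj_rely)
  also have "\<dots> = (?D \<^bold>\<inter> rely (id_on {x})) \<^bold>\<inter> c \<^bold>\<inter> ?R"
    by (simp only: conj_ac)
  also have "\<dots> = ?D \<^bold>\<inter> c \<^bold>\<inter> ?R"
    by (simp add: demand_conj_rely)
  finally have "E x (?D \<^bold>\<inter> (c \<^bold>\<inter> rely (rel_E x r \<inter> id_on {x}))) = E x (?D \<^bold>\<inter> c) \<^bold>\<inter> ?R"
    \<comment> \<open>\<open>loc_conj\<close> requires its second conjunct to be of the form
      \<open>E x d\<close>; \<open>?R\<close> qualifies as a fixed point.\<close>
    using loc_conj[of x "?D \<^bold>\<inter> c" ?R] by (simp only: loc_rely_rel_E)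
  then show ?thesis
    unfolding local_block_def by (simp only: conj_ac)
qed

lemma var_block_conj_rely:
  "var x (c \<^bold>\<inter> rely (rel_E x r \<inter> id_on {x})) \<le> var x c \<^bold>\<inter> rely r"
proof -
  have "local x (c \<^bold>\<inter> rely (rel_E x r \<inter> id_on {x})) \<le> rely r \<^bold>\<inter> local x c"
    unfolding local_block_conj_rely conj_commute[of "rely r"]
    by (intro conj_mono order_refl rely_weaken subset_rel_E)
  then have "var x (c \<^bold>\<inter> rely (rel_E x r \<inter> id_on {x}))
      \<le> (rely r \<^bold>\<inter> idle) \<^bold>; (rely r \<^bold>\<inter> local x c) \<^bold>; (rely r \<^bold>\<inter> idle)"
    \<comment> \<open>Each \<open>idle\<close> acquires its own rely, since conjoining a rely only
      moves a command up the order.\<close>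
    unfolding var_block_def by (intro seq_mono rely_remove)
  \<comment> \<open>Composition associates to the right, so the rely is factored out of the last two
    commands first.\<close>
  also have "\<dots> \<le> (rely r \<^bold>\<inter> idle) \<^bold>; (rely r \<^bold>\<inter> local x c \<^bold>; idle)"
    by (intro seq_mono order_refl rely_conj_seq)
  also have "\<dots> \<le> rely r \<^bold>\<inter> var x c"
    unfolding var_block_def by (rule rely_conj_seq)
  finally show ?thesis
    by (simp add: conj_commute)
qed

end

theorem mainTheorem2:
  fixes K :: "('c::{complete_lattice, distrib_lattice}, 'v::countable, 's) command_ops" (structure)
    and x :: 'v and c :: 'c and r :: "('v, 's) state_rel"
  assumes "localisation_algebra K"
  shows "var x c \<^bold>\<inter> rely r \<ge> var x (c \<^bold>\<inter> rely (rel_E x r \<inter> id_on {x}))"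
  using assms by (rule localisation_algebra.var_block_conj_rely)

end
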